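(* Let $(\mathcal{X},\mathcal{C})$ be an ordered Banach space for which there exist an element $I\in\mathcal{C}$ and a constant $e_{\mathcal{X}}>0$ such that $x\le e_{\mathcal{X}}\|x\|I$ for all $x\in\mathcal{C}$. Let $T$ be a positive linear map on $\mathcal{X}$ with spectral radius $r(T)$. If $T$ is ergodic, then, up to multiplication by a positive scalar, there exists at most one $0\neq x\in\mathcal{C}$ such that $Tx=r(T)x$.
   Context: An ordered Banach space $(\mathcal{X},\mathcal{C})$ is a complex Banach space $\mathcal{X}$ with a closed positive cone $\mathcal{C}\subseteq\mathcal{X}$ (closed under multiplication by nonnegative real scalars) such that $\mathcal{C}\cap(-\mathcal{C})=\{0\}$ and $\mathcal{C}+\mathcal{C}\subseteq\mathcal{C}$. One writes $x\le y$ if $y-x\in\mathcal{C}$. Moreover the cone satisfies: (1) there is a constant $c_{\mathcal{X}}>0$ such that $0\le x\le y$ implies $\|x\|\le c_{\mathcal{X}}\|y\|$; (2) there is a constant $d_{\mathcal{X}}>0$ such that each $x\in\mathcal{X}$ is a linear sum of four positive elements with norms bounded by $d_{\mathcal{X}}\|x\|$, i.e. $x=x_1-x_2+i(x_3-x_4)$ with $x_k\in\mathcal{C}$, $\|x_k\|\le d_{\mathcal{X}}\|x\|$. A positive linear map on $\mathcal{X}$ is a bounded linear map $T:\mathcal{X}\to\mathcal{X}$ with $T\mathcal{C}\subseteq\mathcal{C}$. An element $x\in\mathcal{C}$ is strictly positive if there exists $\lambda>0$ with $\lambda I\le x$. $T$ is ergodic if for every non-zero $x\in\mathcal{C}$ there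 exists an integer $N>0$ such that $\sum_{j=1}^N T^j(x)$ is strictly positive. *)

theory Defs
  imports "HOL-Analysis.Analysis"
begin

text \<open>
  Complex Banach spaces are rendered as real Banach spaces with a compatible complex scalar
  multiplication; \<^term>\<open>scaleC 1 x = x\<close> follows from the compatibility axiom.
\<close>

class complex_banach = banach +
  fixes scaleC :: "complex \<Rightarrow> 'a \<Rightarrow> 'a"  (infixr "*\<^sub>C" 75)
  assumes scaleC_add_right: "a *\<^sub>C (x + y) = a *\<^sub>C x + a *\<^sub>C y"
    and scaleC_add_left: "(a + b) *\<^sub>C x = a *\<^sub>C x + b *\<^sub>C x"
    and scaleC_scaleC: "a *\<^sub>C (b *\<^sub>C x) = (a * b) *\<^sub>C x"
    and scaleR_scaleC: "r *\<^sub>R x = complex_of_real r *\<^sub>C x"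
    and norm_scaleC: "norm (a *\<^sub>C x) = cmod a * norm x"

instantiation complex :: complex_banach
begin

definition scaleC_complex :: "complex \<Rightarrow> complex \<Rightarrow> complex"
  where "scaleC_complex a x = a * x"

instance
  by standard (simp_all add: scaleC_complex_def algebra_simps norm_mult scaleR_conv_of_real)

end

definition bounded_clinear :: "('a::complex_banach \<Rightarrow> 'a) \<Rightarrow> bool"
  where "bounded_clinear T \<longleftrightarrow> bounded_linear T \<and> (\<forall>a x. T (a *\<^sub>C x) = a *\<^sub>C T x)"

definition op_spectrum :: "('a::complex_banach \<Rightarrow> 'a) \<Rightarrow> complex set"
  where "op_spectrum T =
    {z. \<not> (\<exists>S. bounded_clinear S \<and> (\<forall>x. S (T x - z *\<^sub>C x) = x) \<and> (\<forall>x. T (S x) - z *\<^sub>C S x = x))}"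

text \<open>
  For bounded \<open>T\<close> the set below is bounded above, and it is non-empty unless the space is trivial.
\<close>

definition op_spectral_radius :: "('a::complex_banach \<Rightarrow> 'a) \<Rightarrow> real"
  where "op_spectral_radius T = Sup (cmod ` op_spectrum T)"

definition cone_le :: "'a::complex_banach set \<Rightarrow> 'a \<Rightarrow> 'a \<Rightarrow> bool"
  where "cone_le C x y \<longleftrightarrow> y - x \<in> C"

locale ordered_banach_space =
  fixes C :: "'a::complex_banach set"
  assumes closed_cone: "closed C"
    and cone_scale: "\<And>(r::real) x. 0 \<le> r \<Longrightarrow> x \<in> C \<Longrightarrow> r *\<^sub>R x \<in> C"
    and cone_pointed: "C \<inter> uminus ` C = {0}"
    and cone_add: "\<And>x y. x \<in> C \<Longrightarrow> y \<in> C \<Longrightarrow> x + y \<in> C"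
    and cone_normal: "\<exists>c>0. \<forall>x y. cone_le C 0 x \<and> cone_le C x y \<longrightarrow> norm x \<le> c * norm y"
    and cone_generating: "\<exists>d>0. \<forall>x. \<exists>x1\<in>C. \<exists>x2\<in>C. \<exists>x3\<in>C. \<exists>x4\<in>C.
      x = x1 - x2 + \<i> *\<^sub>C (x3 - x4) \<and>
      norm x1 \<le> d * norm x \<and> norm x2 \<le> d * norm x \<and>
      norm x3 \<le> d * norm x \<and> norm x4 \<le> d * norm x"

definition positive_map :: "'a::complex_banach set \<Rightarrow> ('a \<Rightarrow> 'a) \<Rightarrow> bool"
  where "positive_map C T \<longleftrightarrow> bounded_clinear T \<and> T ` C \<subseteq> C"

definition strictly_positive :: "'a::complex_banach set \<Rightarrow> 'a \<Rightarrow> 'a \<Rightarrow> bool"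
  where "strictly_positive C I x \<longleftrightarrow> x \<in> C \<and> (\<exists>l::real. l > 0 \<and> cone_le C (l *\<^sub>R I) x)"

definition ergodic_map :: "'a::complex_banach set \<Rightarrow> 'a \<Rightarrow> ('a \<Rightarrow> 'a) \<Rightarrow> bool"
  where "ergodic_map C I T \<longleftrightarrow>
    (\<forall>x\<in>C. x \<noteq> 0 \<longrightarrow> (\<exists>N>0. strictly_positive C I (\<Sum>j=1..N. (T ^^ j) x)))"

end

theory Submission
  imports Defs
begin

text \<open>
  Ergodicity makes every eigenvector \<open>x \<in> C\<close>, \<open>x \<noteq> 0\<close>, of \<open>T\<close> strictly positive, because
  the sum \<open>\<Sum>j=1..N. (T ^^ j) x\<close> is a real multiple of \<open>x\<close>
  (\<open>eigenvector_strictly_positive\<close>).  As \<open>I\<close> dominates every element of the cone up to a scalar,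
  a strictly positive element does so too (\<open>strictly_positive_minus_scaled\<close>).

  Let \<open>x, y \<in> C\<close> be non-zero eigenvectors for the same eigenvalue, and let \<open>t\<close> be the largest real
  number with \<open>x - t y \<in> C\<close>; it exists since the cone is closed and normal
  (\<open>maximal_multiple_below\<close>).  If \<open>x - t y\<close> were non-zero, it would be an eigenvector in the cone,
  hence strictly positive, and a further small multiple of \<open>y\<close> could be subtracted, against the
  choice of \<open>t\<close>.  Hence \<open>x = t y\<close>.
\<close>

context ordered_banach_space
begin

text \<open>
  The scalar \<open>s\<close> may have any sign: if \<open>s x \<ge> l I\<close>, then also \<open>(\<bar>s\<bar> + 1) x \<ge> l I\<close> because
  \<open>x \<ge> 0\<close>, and this inequality can be divided by its positive coefficient.
\<close>

lemma strictly_positive_of_scaleR: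
  assumes x: "x \<in> C" and sx: "strictly_positive C I (s *\<^sub>R x)"
  shows "strictly_positive C I x"
proof -
  obtain l where l: "l > 0" "s *\<^sub>R x - l *\<^sub>R I \<in> C"
    using sx unfolding strictly_positive_def cone_le_def by blast
  define k where "k = \<bar>s\<bar> + 1"
  have k: "k > 0" "k - s \<ge> 0"
    unfolding k_def by linarith+
  have "(s *\<^sub>R x - l *\<^sub>R I) + (k - s) *\<^sub>R x \<in> C"
    using l(2) cone_scale[OF k(2) x] by (rule cone_add)
  also have "(s *\<^sub>R x - l *\<^sub>R I) + (k - s) *\<^sub>R x = k *\<^sub>R x - l *\<^sub>R I"
    by (simp add: algebra_simps)
  finally have "(1 / k) *\<^sub>R (k *\<^sub>R x - l *\<^sub>R I) \<in> C"
    using k(1) by (intro cone_scale) simp_all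
  then have "x - (l / k) *\<^sub>R I \<in> C"
    using k(1) by (simp add: scaleR_diff_right)
  then show ?thesis
    unfolding strictly_positive_def cone_le_def using x l(1) k(1)
    by (intro conjI exI[of _ "l / k"]) simp_all
qed

lemma eigenvector_strictly_positive:
  assumes T: "linear T" "ergodic_map C I T"
    and x: "x \<in> C" "x \<noteq> 0" "T x = r *\<^sub>R x"
  shows "strictly_positive C I x"
proof -
  have pow: "(T ^^ j) x = r ^ j *\<^sub>R x" for j
    by (induction j) (simp_all add: linear_scale[OF T(1)] x(3) mult.commute)
  obtain N where "strictly_positive C I (\<Sum>j=1..N. (T ^^ j) x)"
    using T(2) x(1,2) unfolding ergodic_map_def by blast
  then have "strictly_positive C I ((\<Sum>j=1..N. r ^ j) *\<^sub>R x)"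
    by (simp add: pow scaleR_sum_left)
  then show ?thesis
    by (rule strictly_positive_of_scaleR[OF x(1)])
qed

lemma strictly_positive_minus_scaled:
  assumes I: "I \<in> C" and y: "cone_le C y (b *\<^sub>R I)" "b \<ge> 0"
    and x: "strictly_positive C I x"
  obtains \<epsilon> :: real where "\<epsilon> > 0" "x - \<epsilon> *\<^sub>R y \<in> C"
proof -
  obtain l where l: "l > 0" "x - l *\<^sub>R I \<in> C"
    using x unfolding strictly_positive_def cone_le_def by blast
  \<comment> \<open>\<open>y \<le> b I \<le> (b + 1) I\<close>, where the summand 1 only prevents a division by zero.\<close>
  define \<epsilon> where "\<epsilon> = l / (b + 1)"
  have \<epsilon>: "\<epsilon> > 0" "\<epsilon> * (b + 1) = l"
    unfolding \<epsilon>_def using l(1) y(2) by simp_all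
  have "(b *\<^sub>R I - y) + I \<in> C"
    using y(1) I unfolding cone_le_def by (intro cone_add)
  then have "(x - l *\<^sub>R I) + \<epsilon> *\<^sub>R ((b *\<^sub>R I - y) + I) \<in> C"
    using l(2) \<epsilon>(1) by (intro cone_add[of "x - l *\<^sub>R I"] cone_scale) simp_all
  also have "(x - l *\<^sub>R I) + \<epsilon> *\<^sub>R ((b *\<^sub>R I - y) + I) = x - \<epsilon> *\<^sub>R y"
    unfolding \<epsilon>(2)[symmetric] by (simp add: algebra_simps)
  finally show ?thesis
    using \<epsilon>(1) that by blast
qed

text \<open>
  Normality turns \<open>0 \<le> t y \<le> x\<close> into \<open>t * norm y \<le> c * norm x\<close>, so the admissible \<open>t\<close> are
  bounded; their supremum is attained because the cone is closed.
\<close>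

lemma maximal_multiple_below:
  assumes x: "x \<in> C" and y: "y \<in> C" "y \<noteq> 0"
  obtains t :: real
  where "t \<ge> 0" "x - t *\<^sub>R y \<in> C" "\<And>s. s \<ge> 0 \<Longrightarrow> x - s *\<^sub>R y \<in> C \<Longrightarrow> s \<le> t"
proof -
  define S where "S = {t. 0 \<le> t \<and> x - t *\<^sub>R y \<in> C}"
  obtain c where c: "\<And>u v. cone_le C 0 u \<Longrightarrow> cone_le C u v \<Longrightarrow> norm u \<le> c * norm v"
    using cone_normal by blast
  have bound: "t \<le> c * norm x / norm y" if "t \<in> S" for t
  proof -
    have t: "t \<ge> 0" "x - t *\<^sub>R y \<in> C"
      using that unfolding S_def by auto
    have "norm (t *\<^sub>R y) \<le> c * norm x"
      using t cone_scale[OF t(1) y(1)] by (intro c) (simp_all add: cone_le_def)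
    then show ?thesis
      using t(1) y(2) by (simp add: pos_le_divide_eq)
  qed
  have "S \<noteq> {}"
    using x unfolding S_def by (auto intro: exI[of _ 0])
  moreover have bdd: "bdd_above S"
    using bound by (rule bdd_aboveI)
  moreover have "closed S"
  proof -
    have "S = {0..} \<inter> (\<lambda>t. x - t *\<^sub>R y) -` C"
      unfolding S_def by auto
    moreover have "closed ((\<lambda>t::real. x - t *\<^sub>R y) -` C)"
      by (intro closed_vimage closed_cone continuous_intros)
    ultimately show ?thesis
      by (simp add: closed_Int)
  qed
  ultimately have "Sup S \<in> S"
    by (rule closed_contains_Sup)
  then show ?thesis
    using that[of "Sup S"] cSup_upper[OF _ bdd] unfolding S_def by blast
qed

lemma ergodic_eigenvector_unique:
  assumes I: "I \<in> C" and e: "e > 0"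
    and unit: "\<And>z. z \<in> C \<Longrightarrow> cone_le C z ((e * norm z) *\<^sub>R I)"
    and T: "linear T" "ergodic_map C I T"
    and x: "x \<in> C" "x \<noteq> 0" "T x = r *\<^sub>R x"
    and y: "y \<in> C" "y \<noteq> 0" "T y = r *\<^sub>R y"
  shows "\<exists>c>0. y = c *\<^sub>R x"
proof -
  obtain t where t: "t \<ge> 0" "x - t *\<^sub>R y \<in> C"
    and max: "\<And>s. s \<ge> 0 \<Longrightarrow> x - s *\<^sub>R y \<in> C \<Longrightarrow> s \<le> t"
    by (rule maximal_multiple_below[OF x(1) y(1,2)]) blast
  have "x - t *\<^sub>R y = 0"
  proof (rule ccontr)
    assume nz: "x - t *\<^sub>R y \<noteq> 0"
    have "T (x - t *\<^sub>R y) = r *\<^sub>R (x - t *\<^sub>R y)"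
      using x(3) y(3) by (simp add: linear_diff[OF T(1)] linear_scale[OF T(1)] algebra_simps)
    then have "strictly_positive C I (x - t *\<^sub>R y)"
      by (rule eigenvector_strictly_positive[OF T t(2) nz])
    then obtain \<epsilon> where \<epsilon>: "\<epsilon> > 0" "(x - t *\<^sub>R y) - \<epsilon> *\<^sub>R y \<in> C"
      using strictly_positive_minus_scaled[OF I unit[OF y(1)]] e
      by (metis less_eq_real_def mult_nonneg_nonneg norm_ge_zero)
    then have "x - (t + \<epsilon>) *\<^sub>R y \<in> C"
      by (simp add: algebra_simps)
    then show False
      using max[of "t + \<epsilon>"] t(1) \<epsilon>(1) by simp
  qed
  then have xt: "x = t *\<^sub>R y"
    by simp
  then have "t > 0"
    using x(2) t(1) by (cases "t = 0") simp_all
  with xt show ?thesis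
    by (intro exI[of _ "1 / t"]) simp
qed

end

theorem theorem4p11:
  fixes C :: "'a::complex_banach set" and I :: 'a and e :: real and T :: "'a \<Rightarrow> 'a"
  assumes "ordered_banach_space C"
    and "I \<in> C"
    and "e > 0"
    and "\<And>x. x \<in> C \<Longrightarrow> cone_le C x ((e * norm x) *\<^sub>R I)"
    and "positive_map C T"
    and "ergodic_map C I T"
  shows "\<forall>x y. x \<in> C \<and> x \<noteq> 0 \<and> T x = op_spectral_radius T *\<^sub>R x \<and>
               y \<in> C \<and> y \<noteq> 0 \<and> T y = op_spectral_radius T *\<^sub>R y
               \<longrightarrow> (\<exists>c::real. c > 0 \<and> y = c *\<^sub>R x)"
proof -
  interpret ordered_banach_space C
    by fact
  have "linear T"
    using assms(5) unfolding positive_map_def bounded_clinear_def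
    by (simp add: bounded_linear.linear)
  then show ?thesis
    using ergodic_eigenvector_unique[OF assms(2-4) _ assms(6)] by blast
qed

end
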